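(* Consider the 62-trick cycle of states of two-player Beggar-My-Neighbor that passes through the state (top card of each hand at the left) Player 1: $\texttt{---AAJ--J--------K---------Q-Q-K---Q-KAQJ-}$ Player 2: $\texttt{-----KA-J-}$ with player 2 to play next. There exist 30 pairwise distinct starting deals of a standard 52-card deck (26 cards to each player, with either player 1 or player 2 designated to start) such that the game played from each of them reaches a state on this cycle; consequently each of these 30 starting deals gives a non-terminating game.
   Context: Cards and hands. Suits are irrelevant. A card is one of: an ace $\texttt{A}$, a king $\texttt{K}$, a queen $\texttt{Q}$, a jack $\texttt{J}$ (these four types are the court, or face, cards), or a number card, written $\texttt{-}$. A standard deck has 52 cards: 4 each of $\texttt{A},\texttt{K},\texttt{Q},\texttt{J}$ and 36 number cards. A hand (pack) is a finite sequence of cards, written as a string with the top of the hand (next card to be played) at the left. In the strings, each single hyphen is one number card. State. A state (between tricks) consists of the hand of player 1, the hand of player 2, and which player is to play next (start the next trick). A starting deal is a state in which each player has 26 cards and the two hands together form a standard deck; two starting deals are distinct if they differ as states (suits being ignored). Rules of Beggar-My-Neighbor. The player to start lays the top card of his hand face up on the (initially empty) table pile; the players then alternate, each laying the top card of his hand on the pile, as long as no court card appears. When a player lays a court card, his opponent has to pay: he must lay up to 4 cards in succession for an ace, 3 for a king, 2 for a queen, 1 for a jack, taken from the top of his hand. If all the required cards are number cards, the player who laid the court card wins the trick. If during the payment a court card is laid, the payment stops at once and the roles are reversed: the other player now has to pay to this new court card in the same way; the trick continues until some player pays in full with number cards only. The winner of the trick takes the whole pile and places it under (at the bottom of) his hand,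 in the order the cards were played (the first card played in the trick is nearest the top, so in string notation the pile, written in order of play, is appended at the right end of the winner's string). The winner of the trick starts the next trick. Termination. The game terminates if one player gets all the cards (in particular if a player who must lay a card has none left, in which case his opponent gets all the cards and wins). A game is non-terminating if it continues through infinitely many tricks. Play is deterministic. The cycle. Playing from the state displayed in the claim, the game returns to that same state for the first time after exactly 62 tricks; the cycle is the set of 62 states so visited. *)

theory Defs
  imports "HOL-Library.Multiset"
begin

datatype card = Ace | King | Queen | Jack | Number

fun penalty :: "card \<Rightarrow> nat option" where
  "penalty Ace = Some 4"
| "penalty King = Some 3"
| "penalty Queen = Some 2"
| "penalty Jack = Some 1"
| "penalty Number = None"

text \<open>The head of the list is the top of the hand.\<close>

type_synonym hand = "card list"

text \<open>Any character other than A, K, Q, J is read as a number card.\<close>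

definition card_of_char :: "char \<Rightarrow> card" where
  "card_of_char c =
     (if c = CHR ''A'' then Ace
      else if c = CHR ''K'' then King
      else if c = CHR ''Q'' then Queen
      else if c = CHR ''J'' then Jack
      else Number)"

definition hand_of_string :: "string \<Rightarrow> hand" where
  "hand_of_string s = map card_of_char s"

datatype player = Player1 | Player2

fun opponent :: "player \<Rightarrow> player" where
  "opponent Player1 = Player2"
| "opponent Player2 = Player1"

datatype state = State (hand1: hand) (hand2: hand) (to_play: player)

fun state_with :: "player \<Rightarrow> hand \<Rightarrow> hand \<Rightarrow> state" where
  "state_with Player1 own other = State own other Player1"
| "state_with Player2 own other = State other own Player2"

text \<open>
  Within a trick, either no court card has appeared yet and the players alternate, or the
  player whose turn it is still owes the stated number of cards to the last court card.
\<close>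

datatype phase = Alternating | Owing nat

text \<open>
  In \<open>play_on p ph pile own other\<close>, player \<open>p\<close> is the one to lay, with hand \<open>own\<close>; the
  opponent holds \<open>other\<close>, and \<open>pile\<close> lists the cards on the table in order of play. The
  result is the state after the trick, or \<open>None\<close> if a player has to lay a card but has
  none, so that the opponent gets all the cards and the game is over.
\<close>

function play_on :: "player \<Rightarrow> phase \<Rightarrow> card list \<Rightarrow> hand \<Rightarrow> hand \<Rightarrow> state option" where
  "play_on p (Owing 0) pile own other = Some (state_with (opponent p) (other @ pile) own)"
| "play_on p (Owing (Suc k)) pile [] other = None"
| "play_on p (Owing (Suc k)) pile (c # own) other =
     (case penalty c of
        Some m \<Rightarrow> play_on (opponent p) (Owing m) (pile @ [c]) other own
      | None \<Rightarrow> play_on p (Owing k) (pile @ [c]) own other)"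
| "play_on p Alternating pile [] other = None"
| "play_on p Alternating pile (c # own) other =
     (case penalty c of
        Some m \<Rightarrow> play_on (opponent p) (Owing m) (pile @ [c]) other own
      | None \<Rightarrow> play_on (opponent p) Alternating (pile @ [c]) other own)"
  by pat_completeness auto
termination
  by (relation "measure (\<lambda>(p, ph, pile, own, other). length own + length other)") auto

text \<open>
  The state after the next trick; \<open>None\<close> if the game is already over because one player has
  all the cards, or if it ends during this trick.
\<close>

fun next_state :: "state \<Rightarrow> state option" where
  "next_state (State h1 h2 p) =
     (if h1 = [] \<or> h2 = [] then None
      else case p of
        Player1 \<Rightarrow> play_on Player1 Alternating [] h1 h2
      | Player2 \<Rightarrow> play_on Player2 Alternating [] h2 h1)"

fun after_tricks :: "nat \<Rightarrow> state \<Rightarrow> state option" where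
  "after_tricks 0 s = Some s"
| "after_tricks (Suc n) s = Option.bind (next_state s) (after_tricks n)"

definition reaches :: "state \<Rightarrow> state \<Rightarrow> bool" where
  "reaches s t \<longleftrightarrow> (\<exists>n. after_tricks n s = Some t)"

definition non_terminating :: "state \<Rightarrow> bool" where
  "non_terminating s \<longleftrightarrow> (\<forall>n. after_tricks n s \<noteq> None)"

definition first_return_after :: "nat \<Rightarrow> state \<Rightarrow> bool" where
  "first_return_after n s \<longleftrightarrow>
     0 < n \<and> after_tricks n s = Some s \<and> (\<forall>k. 0 < k \<and> k < n \<longrightarrow> after_tricks k s \<noteq> Some s)"

definition standard_deck :: "card multiset" where
  "standard_deck =
     replicate_mset 4 Ace + replicate_mset 4 King + replicate_mset 4 Queen
     + replicate_mset 4 Jack + replicate_mset 36 Number"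

definition starting_deal :: "state \<Rightarrow> bool" where
  "starting_deal s \<longleftrightarrow>
     length (hand1 s) = 26 \<and> length (hand2 s) = 26 \<and>
     mset (hand1 s) + mset (hand2 s) = standard_deck"

definition base_state :: state where
  "base_state =
     State (hand_of_string ''---AAJ--J--------K---------Q-Q-K---Q-KAQJ-'')
           (hand_of_string ''-----KA-J-'')
           Player2"

definition base_cycle :: "state set" where
  "base_cycle = {t. \<exists>n<62. after_tricks n base_state = Some t}"

end

(*
  The deals were found by playing backwards from the 62 states of the cycle. In reverse, a trick
  is undone by removing from the bottom of the leader's hand a suffix that could have been a pile
  won by that player; the resulting tree of predecessors is finite, and exactly 30 of its states
  are starting deals. Checking them only needs forward play, four to six tricks per deal.
*)

theory Submission
  imports Defs
begin

lemma after_tricks_add: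
  "after_tricks (m + n) s = Option.bind (after_tricks m s) (after_tricks n)"
  by (induction m arbitrary: s) (auto split: Option.bind_split)

text \<open>A game that has ended stays ended, so \<open>None\<close> after n tricks would force
  \<open>None\<close> after every larger number of tricks, in particular after a multiple of p,
  where play is back at \<open>s\<close>.\<close>

lemma non_terminating_if_periodic:
  assumes "0 < p" and period: "after_tricks p s = Some s"
  shows "non_terminating s"
proof -
  have multiple: "after_tricks (k * p) s = Some s" for k
    by (induction k) (simp_all add: after_tricks_add period)
  have "after_tricks n s \<noteq> None" for n
  proof
    assume "after_tricks n s = None"
    then have "after_tricks (n + (n * p - n)) s = None"
      by (simp only: after_tricks_add Option.bind.simps)
    \<comment> \<open>The subtraction does not truncate, since \<open>0 < p\<close> gives n \<le> n
      * p.\<close>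
    moreover have "n + (n * p - n) = n * p"
      using \<open>0 < p\<close> by simp
    ultimately show False
      using multiple by simp
  qed
  then show ?thesis
    by (simp add: non_terminating_def)
qed

lemma non_terminating_forward:
  assumes "non_terminating s" and "after_tricks n s = Some t"
  shows "non_terminating t"
  using assms after_tricks_add[of n _ s] unfolding non_terminating_def
  by (metis Option.bind.simps(2))

text \<open>If play from \<open>s\<close> had ended after k tricks, it would also have ended after k
  + n = n + k tricks, that is, k tricks after \<open>t\<close>.\<close>

lemma non_terminating_backward:
  assumes "after_tricks n s = Some t" and "non_terminating t"
  shows "non_terminating s"
  unfolding non_terminating_def
proof (intro allI notI)
  fix k
  assume "after_tricks k s = None"
  then have "after_tricks (k + n) s = None"
    by (simp add: after_tricks_add)
  moreover have "after_tricks (n + k) s = after_tricks k t"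
    by (simp add: after_tricks_add assms(1))
  ultimately have "after_tricks k t = None"
    by (simp add: add.commute)
  then show False
    using assms(2) unfolding non_terminating_def by blast
qed

text \<open>Equal states at times i < j < p would stay equal for another p - j tricks, and
  \<open>s\<close> would then recur too early, after i + (p - j) tricks.\<close>

lemma card_cycle:
  assumes "first_return_after p s"
  shows "card {t. \<exists>n<p. after_tricks n s = Some t} = p"
proof -
  have period: "after_tricks p s = Some s"
    and first: "\<And>k. 0 < k \<Longrightarrow> k < p \<Longrightarrow> after_tricks k s \<noteq> Some s"
    and "0 < p"
    using assms by (auto simp: first_return_after_def)
  then have defined: "after_tricks n s \<noteq> None" for n
    using non_terminating_if_periodic by (simp add: non_terminating_def)
  have distinct: "after_tricks i s \<noteq> after_tricks j s" if "i < j" "j < p" for i j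
  proof
    assume "after_tricks i s = after_tricks j s"
    then have "after_tricks (i + (p - j)) s = after_tricks (j + (p - j)) s"
      by (simp only: after_tricks_add)
    then have "after_tricks (i + (p - j)) s = Some s"
      using that period by simp
    then show False
      \<comment> \<open>The index is positive because j < p, and below p because i < j.\<close>
      using first[of "i + (p - j)"] that by linarith
  qed
  \<comment> \<open>All values are \<open>Some\<close>, so applying \<open>the\<close> merges no two
    of them.\<close>
  have "inj_on (\<lambda>n. the (after_tricks n s)) {..<p}"
  proof (rule linorder_inj_onI)
    fix i j
    assume "i < j" "j \<in> {..<p}"
    then show "the (after_tricks i s) \<noteq> the (after_tricks j s)"
      using distinct[of i j] defined option.expand by blast
  qed auto
  moreover have "{t. \<exists>n<p. after_tricks n s = Some t} = (\<lambda>n. the (after_tricks n s)) ` {..<p}"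
    using defined by force
  ultimately show ?thesis
    by (simp add: card_image)
qed

text \<open>Walks along the play once, comparing each state with \<open>t\<close>, so that
  evaluation need not replay the game from its start for every k.\<close>

primrec first_hit :: "state \<Rightarrow> nat \<Rightarrow> state \<Rightarrow> bool" where
  "first_hit t 0 s \<longleftrightarrow> s = t"
| "first_hit t (Suc n) s \<longleftrightarrow>
     s \<noteq> t \<and> (case next_state s of None \<Rightarrow> False | Some s' \<Rightarrow> first_hit t n s')"

lemma first_hit_iff:
  "first_hit t n s \<longleftrightarrow>
     after_tricks n s = Some t \<and> (\<forall>k<n. after_tricks k s \<noteq> Some t)"
  \<comment> \<open>\<open>All_less_Suc2\<close> splits off k = 0, the test on \<open>s\<close>
    itself; the remaining indices belong to the successor state.\<close>
  by (induction n arbitrary: s) (auto simp: All_less_Suc2 split: option.splits)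

text \<open>Play starts at \<open>s\<close>, so time 0 must be left out of the search; searching
  from the successor does this and shifts every count by one. The right-hand side can be
  evaluated.\<close>

lemma first_return_after_Suc_iff:
  "first_return_after (Suc n) s \<longleftrightarrow>
     (case next_state s of None \<Rightarrow> False | Some s' \<Rightarrow> first_hit s n s')"
proof -
  have "(\<forall>k. 0 < k \<and> k < Suc n \<longrightarrow> P k) \<longleftrightarrow> (\<forall>k<n. P (Suc k))" for P
    by (metis Suc_less_eq gr0_implies_Suc zero_less_Suc)
  then show ?thesis
    by (simp add: first_return_after_def first_hit_iff split: option.splits)
qed

lemma first_return_base: "first_return_after 62 base_state"
proof -
  \<comment> \<open>The count is 61 because \<open>next_state\<close> already plays the first of the
    62 tricks.\<close>
  have "case next_state base_state of None \<Rightarrow> False | Some s \<Rightarrow> first_hit base_state 61 s"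
    by code_simp
  then show ?thesis
    using first_return_after_Suc_iff[of 61 base_state] by simp
qed

text \<open>
  An entry \<open>(n, m, ds)\<close> lists deals from which \<open>n\<close> tricks lead to the state
  \<open>m\<close> tricks after \<^const>\<open>base_state\<close>.
\<close>

definition deal_table :: "(nat \<times> nat \<times> (string \<times> string \<times> player) list) list" where
  "deal_table = [
    (4, 0, [
      (''--K---Q-KQAJ-----AAJ--J---'', ''----------Q----KQ-J-----KA'', Player2),
      (''---K---Q-KQAJ-----AAJ--J--'', ''----------Q----KQ-J-----KA'', Player1),
      (''--K---Q-KQAJA----AAJ--J---'', ''----------Q----KQ--J-----K'', Player2),
      (''---K---Q-KQAJA----AAJ--J--'', ''----------Q----KQ--J-----K'', Player1),
      (''---K---Q-KQAJ-A----AAJ--J-'', ''-----------Q----KQ-K-J----'', Player2),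
      (''----K---Q-KQAJ-A----AAJ--J'', ''-----------Q----KQ-K-J----'', Player1)]),
    (5, 15, [
      (''K---Q-KAQJ--KAAJ--J--Q----'', ''-------------KQ-J--------A'', Player1),
      (''K---Q-KAQJA-KAAJ--J--Q----'', ''-------------KQ--J--------'', Player1),
      (''K---Q-KAQJ-A-KAAJ--J--Q---'', ''--------------KQ---J------'', Player2),
      (''-K---Q-KAQJ-A-KAAJ--J--Q--'', ''--------------KQ---J------'', Player1),
      (''-K---Q-KAQJ--A-KAAJ--J--Q-'', ''---------------KQ----J----'', Player2),
      (''--K---Q-KAQJ--A-KAAJ--J--Q'', ''---------------KQ----J----'', Player1)]),
    (6, 15, [
      (''Q-K---Q-KAQJ---A-KAAJ--J--'', ''----------------KQ-----J--'', Player1),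
      (''Q-K---Q-KAQJ----A-KAAJ--J-'', ''-----------------KQ------J'', Player2),
      (''-Q-K---Q-KAQJ----A-KAAJ--J'', ''-----------------KQ------J'', Player1)]),
    (4, 31, [
      (''--K---A-KQQJ-----AAJ--J---'', ''----------Q----KQ-J-----KA'', Player2),
      (''---K---A-KQQJ-----AAJ--J--'', ''----------Q----KQ-J-----KA'', Player1),
      (''--K---A-KQQJA----AAJ--J---'', ''----------Q----KQ--J-----K'', Player2),
      (''---K---A-KQQJA----AAJ--J--'', ''----------Q----KQ--J-----K'', Player1),
      (''---K---A-KQQJ-A----AAJ--J-'', ''-----------Q----KQ-K-J----'', Player2),
      (''----K---A-KQQJ-A----AAJ--J'', ''-----------Q----KQ-K-J----'', Player1)]),
    (5, 46, [
      (''K---Q-KQQJ--KAAJ--J--Q----'', ''-------------KA-J--------A'', Player1),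
      (''K---Q-KQQJA-KAAJ--J--Q----'', ''-------------KA--J--------'', Player1),
      (''K---Q-KQQJ-A-KAAJ--J--Q---'', ''--------------KA---J------'', Player2),
      (''-K---Q-KQQJ-A-KAAJ--J--Q--'', ''--------------KA---J------'', Player1),
      (''-K---Q-KQQJ--A-KAAJ--J--Q-'', ''---------------KA----J----'', Player2),
      (''--K---Q-KQQJ--A-KAAJ--J--Q'', ''---------------KA----J----'', Player1)]),
    (6, 46, [
      (''Q-K---Q-KQQJ---A-KAAJ--J--'', ''----------------KA-----J--'', Player1),
      (''Q-K---Q-KQQJ----A-KAAJ--J-'', ''-----------------KA------J'', Player2),
      (''-Q-K---Q-KQQJ----A-KAAJ--J'', ''-----------------KA------J'', Player1)])]"

definition table_deals :: "(nat \<times> nat \<times> state) list" where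
  "table_deals =
     [(n, m, State (hand_of_string a) (hand_of_string b) p).
        (n, m, ds) \<leftarrow> deal_table, (a, b, p) \<leftarrow> ds]"

definition deals :: "state list" where
  "deals = map (snd \<circ> snd) table_deals"

lemma distinct_deals: "distinct deals"
  by code_simp

lemma length_deals: "length deals = 30"
  by code_simp

lemma starting_deal_deals: "list_all starting_deal deals"
  by code_simp

text \<open>Both sides are compared as options, so a common \<open>None\<close> is not excluded
  here; the non-termination of \<open>base_state\<close> rules it out afterwards.\<close>

lemma deals_join_cycle:
  "list_all (\<lambda>(n, m, d). m < 62 \<and> after_tricks n d = after_tricks m base_state) table_deals"
  by code_simp

theorem mainTheorem2:
  shows "first_return_after 62 base_state \<and> card base_cycle = 62 \<and>
    (\<exists>D :: state set. finite D \<and> card D = 30 \<and>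
       (\<forall>d\<in>D. starting_deal d \<and> (\<exists>t\<in>base_cycle. reaches d t) \<and> non_terminating d))"
proof (intro conjI exI ballI)
  have base: "non_terminating base_state"
    using first_return_base non_terminating_if_periodic[of 62]
    by (simp add: first_return_after_def)
  show "first_return_after 62 base_state"
    by (fact first_return_base)
  show "card base_cycle = 62"
    unfolding base_cycle_def by (rule card_cycle[OF first_return_base])
  show "finite (set deals)"
    by simp
  show "card (set deals) = 30"
    using distinct_deals length_deals by (simp add: distinct_card)
  fix d
  assume d: "d \<in> set deals"
  then show "starting_deal d"
    using starting_deal_deals by (simp add: list_all_iff)
  obtain n m where m: "m < 62" and nm: "after_tricks n d = after_tricks m base_state"
    using d deals_join_cycle by (fastforce simp: deals_def list_all_iff)
  obtain t where t: "after_tricks m base_state = Some t"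
    using base by (auto simp: non_terminating_def)
  show "\<exists>t\<in>base_cycle. reaches d t"
    using m nm t by (auto simp: base_cycle_def reaches_def)
  show "non_terminating d"
    \<comment> \<open>Non-termination passes from \<open>base_state\<close> forward to
      \<open>t\<close>, and from \<open>t\<close> back to \<open>d\<close>.\<close>
    using nm t base non_terminating_forward non_terminating_backward by metis
qed

end
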